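(* Let $p_1,p_2$ be different prime numbers, let $n_1,n_2,n_3$ be positive integers such that $n_1p_1$ is coprime with $n_2p_2$, and put $N=n_1n_2n_3p_1p_2$. Let $H$ be the subgroup $H=n_3\mathbb{I}_{n_1p_1n_2p_2}$ of $\mathbb{Z}_N$, and let $K$ be a complete set of coset representatives for $\mathbb{Z}_N$ modulo $H$ such that $K$ is the disjoint union $K=K_1\cup K_2$. Let $\alpha\in\{1,n_1,p_1\}$, $\beta\in\{1,n_2,p_2\}$, and define subsets of $\mathbb{Z}_N$ by $$A=n_1p_1n_3\mathbb{I}_{n_2},\qquad B=n_2p_2n_3\mathbb{I}_{n_1},$$ $$U=n_1n_2n_3p_1\mathbb{I}_{p_2},\qquad V=n_1n_2n_3p_2\mathbb{I}_{p_1},$$ $$U'=\alpha n_2n_3\mathbb{I}_{p_2},\qquad V'=\beta n_1n_3\mathbb{I}_{p_1}.$$ Let $$S=A+B,\qquad R=(U+V'+K_1)\cup(U'+V+K_2).$$ If $R$ is a non-periodic subset of $\mathbb{Z}_N$, then $(S,R)$ is a Vuza canon of $\mathbb{Z}_N$.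
   Context: $\mathbb{Z}_N=\{0,1,\dots,N-1\}$ denotes the cyclic group of order $N$ (addition modulo $N$). For positive integers $k,a$, $k\mathbb{I}_a=\{0,\ k\bmod N,\ 2k\bmod N,\dots,(a-1)k\bmod N\}\subseteq\mathbb{Z}_N$. Sums of subsets are $X+Y=\{x+y:x\in X,y\in Y\}$. For non-empty subsets $S,R$ of a finite cyclic group $G$, $G=S\oplus R$ means that every $g\in G$ can be written uniquely as $g=s+r$ with $s\in S$, $r\in R$. A non-empty subset $T$ of $G$ is periodic if there is $g\in G$, $g\neq0$, with $T+g=T$; otherwise it is non-periodic. A Vuza canon of $G$ is a pair $(S,R)$ of non-empty subsets of $G$ such that $G=S\oplus R$ and neither $S$ nor $R$ is periodic. *)

theory Defs
  imports "HOL-Algebra.Elementary_Groups" "HOL-Computational_Algebra.Primes"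
begin

(* integer_mod_group N is the additive group {0..<N} with addition modulo N; sums of subsets
   are rendered by set_mult (written <#>) and translates T + g by r_coset (written #>). *)

(* The subset k I_a of Z_N; intended for N > 0. *)
definition multiples_mod :: "nat \<Rightarrow> nat \<Rightarrow> nat \<Rightarrow> int set"
  where "multiples_mod N k a = (\<lambda>i. int ((i * k) mod N)) ` {..<a}"

definition direct_sum_decomp :: "('a, 'b) monoid_scheme \<Rightarrow> 'a set \<Rightarrow> 'a set \<Rightarrow> bool"
  where "direct_sum_decomp G S R \<longleftrightarrow>
    S \<noteq> {} \<and> R \<noteq> {} \<and> S \<subseteq> carrier G \<and> R \<subseteq> carrier G \<and>
    (\<forall>g\<in>carrier G. \<exists>!p. p \<in> S \<times> R \<and> g = fst p \<otimes>\<^bsub>G\<^esub> snd p)"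

definition periodic_subset :: "('a, 'b) monoid_scheme \<Rightarrow> 'a set \<Rightarrow> bool"
  where "periodic_subset G T \<longleftrightarrow>
    T \<noteq> {} \<and> T \<subseteq> carrier G \<and> (\<exists>g\<in>carrier G. g \<noteq> \<one>\<^bsub>G\<^esub> \<and> T #>\<^bsub>G\<^esub> g = T)"

definition non_periodic_subset :: "('a, 'b) monoid_scheme \<Rightarrow> 'a set \<Rightarrow> bool"
  where "non_periodic_subset G T \<longleftrightarrow> T \<noteq> {} \<and> T \<subseteq> carrier G \<and> \<not> periodic_subset G T"

definition vuza_canon :: "('a, 'b) monoid_scheme \<Rightarrow> 'a set \<Rightarrow> 'a set \<Rightarrow> bool"
  where "vuza_canon G S R \<longleftrightarrow>
    direct_sum_decomp G S R \<and> non_periodic_subset G S \<and> non_periodic_subset G R"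

definition complete_coset_reps :: "('a, 'b) monoid_scheme \<Rightarrow> 'a set \<Rightarrow> 'a set \<Rightarrow> bool"
  where "complete_coset_reps G H K \<longleftrightarrow>
    K \<subseteq> carrier G \<and> (\<forall>C\<in>rcosets\<^bsub>G\<^esub> H. \<exists>!x. x \<in> K \<inter> C)"

end

theory Submission
  imports Defs "HOL-Number_Theory.Cong"
begin

text \<open>
  Write \<open>a = n\<^sub>1 p\<^sub>1\<close>, \<open>b = n\<^sub>2 p\<^sub>2\<close> and \<open>M = a b\<close>, with \<open>a\<close> and \<open>b\<close> coprime. All of
  \<open>A\<close>, \<open>B\<close>, \<open>U\<close>, \<open>V\<close>, \<open>U'\<close>, \<open>V'\<close> lie in \<open>H\<close>, the group of multiples of \<open>n\<^sub>3\<close>, which is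
  a copy of \<open>\<int>\<^sub>M\<close>.

  The heart of the matter is that \<open>S = A + B\<close> has two complements in \<open>H\<close>:
  \<open>H = S \<oplus> (U + V')\<close> and \<open>H = S \<oplus> (U' + V)\<close>. For the first, \<open>A + U\<close> is the whole
  subgroup of multiples of \<open>a\<close>, written in mixed radix (a digit below \<open>n\<^sub>2\<close> and one below
  \<open>p\<^sub>2\<close>). Modulo that subgroup, in \<open>\<int>\<^sub>a\<close>, the set \<open>B\<close> represents every class
  modulo \<open>n\<^sub>1\<close> once since \<open>b\<close> is a unit there, while \<open>V'\<close> runs once through the multiples
  of \<open>n\<^sub>1\<close> since \<open>\<beta>\<close> is a unit modulo \<open>p\<^sub>1\<close>; so \<open>B + V'\<close> represents \<open>\<int>\<^sub>a\<close>
  exactly once (\<open>mixed_radix_tiling\<close>, \<open>multiples_mod_direct_sum_decomp\<close>). The second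
  factorization is the first with the indices 1 and 2 exchanged.

  Each coset \<open>H + k\<close> is then tiled by \<open>S\<close> with either complement translated by \<open>k\<close>, and
  the choice may depend on \<open>k\<close>. Using \<open>U + V'\<close> for \<open>k \<in> K\<^sub>1\<close> and \<open>U' + V\<close> for
  \<open>k \<in> K\<^sub>2\<close> gives \<open>S \<oplus> R = \<int>\<^sub>N\<close> (\<open>direct_sum_decomp_split_transversal\<close>).

  Finally \<open>S\<close> is never periodic: under the Chinese remainder theorem it becomes, up to
  units, a product of an interval of length \<open>n\<^sub>1 < a\<close> and one of length \<open>n\<^sub>2 < b\<close>, and a
  proper interval in a cyclic group has no period (\<open>sum_of_multiples_mod_not_periodic\<close>).
\<close>

section \<open>Tiling the cosets of a subgroup one by one\<close>

text \<open>
  A translate of \<open>S \<oplus> W = H\<close> by \<open>k\<close> tiles the coset \<open>H #> k\<close> by \<open>S\<close>, and the cosets are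
  disjoint, so the complement \<open>W\<close> can be chosen separately for each representative \<open>k\<close>.
\<close>

lemma (in comm_group) direct_sum_decomp_split_transversal:
  assumes H: "subgroup H G"
    and K: "complete_coset_reps G H (K1 \<union> K2)" and disj: "K1 \<inter> K2 = {}"
    and W1: "direct_sum_decomp (G\<lparr>carrier := H\<rparr>) S W1"
    and W2: "direct_sum_decomp (G\<lparr>carrier := H\<rparr>) S W2"
  shows "direct_sum_decomp G S ((W1 <#> K1) \<union> (W2 <#> K2))"
proof -
  \<comment> \<open>The complement used over \<open>k\<close>: both cases are handled at once as \<open>S \<oplus> W k = H\<close>.\<close>
  define W where "W k = (if k \<in> K1 then W1 else W2)" for k
  define R where "R = (W1 <#> K1) \<union> (W2 <#> K2)"
  have KG: "K1 \<union> K2 \<subseteq> carrier G" using K by (simp add: complete_coset_reps_def)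
  have HG: "H \<subseteq> carrier G" using H subgroup.subset by blast
  have R_iff: "r \<in> R \<longleftrightarrow> (\<exists>k\<in>K1 \<union> K2. \<exists>w\<in>W k. r = w \<otimes> k)" for r
    using disj unfolding R_def W_def set_mult_def by (auto split: if_splits)
  have ne: "S \<noteq> {}" "W1 \<noteq> {}" "W2 \<noteq> {}" and SH: "S \<subseteq> H" and WH: "W k \<subseteq> H" for k
    using W1 W2 unfolding direct_sum_decomp_def W_def by auto
  have dec: "\<exists>!p. p \<in> S \<times> W k \<and> h = fst p \<otimes> snd p" if "h \<in> H" for h k
    using W1 W2 that unfolding direct_sum_decomp_def W_def by simp
  have rep: "\<exists>!k. k \<in> K1 \<union> K2 \<and> k \<in> H #> g" if "g \<in> carrier G" for g
    using K rcosetsI[OF HG that] unfolding complete_coset_reps_def by simp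
  have coset: "H #> (h \<otimes> k) = H #> k" if "h \<in> H" "k \<in> carrier G" for h k
    using that H HG repr_independence rcosI by metis
  have ex: "\<exists>p. p \<in> S \<times> R \<and> g = fst p \<otimes> snd p" if g: "g \<in> carrier G" for g
  proof -
    obtain k where k: "k \<in> K1 \<union> K2" "k \<in> H #> g" using rep[OF g] by blast
    have "g \<in> H #> k" using repr_independence[OF k(2) g H] rcos_self[OF g H] by simp
    then obtain h where h: "h \<in> H" "g = h \<otimes> k" by (auto simp: r_coset_def)
    obtain s w where sw: "s \<in> S" "w \<in> W k" "h = s \<otimes> w"
      using ex1_implies_ex[OF dec[OF h(1), of k]] by auto
    have "s \<in> carrier G" "w \<in> carrier G" "k \<in> carrier G"
      using sw k(1) KG SH WH HG by blast+
    then have "g = s \<otimes> (w \<otimes> k)"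
      using h sw(3) by (simp add: m_assoc)
    then show ?thesis using sw k R_iff by (intro exI[of _ "(s, w \<otimes> k)"]) auto
  qed
  have uniq: "s = s' \<and> r = r'"
    if srs: "s \<in> S" "s' \<in> S" "r \<in> R" "r' \<in> R" "s \<otimes> r = s' \<otimes> r'" for s s' r r'
  proof -
    obtain k w where kw: "k \<in> K1 \<union> K2" "w \<in> W k" "r = w \<otimes> k" using srs(3) R_iff by blast
    obtain k' w' where kw': "k' \<in> K1 \<union> K2" "w' \<in> W k'" "r' = w' \<otimes> k'"
      using srs(4) R_iff by blast
    have carr: "s \<in> carrier G" "s' \<in> carrier G" "w \<in> carrier G" "w' \<in> carrier G"
        "k \<in> carrier G" "k' \<in> carrier G"
      using srs kw kw' SH WH HG KG by blast+
    have inH: "s \<otimes> w \<in> H" "s' \<otimes> w' \<in> H"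
      using srs kw kw' SH WH subgroup.m_closed[OF H] by blast+
    have eq: "(s \<otimes> w) \<otimes> k = (s' \<otimes> w') \<otimes> k'"
      using srs(5) kw kw' carr by (simp add: m_assoc)
    have "H #> k = H #> k'"
      using coset[OF inH(1) carr(5)] coset[OF inH(2) carr(6)] eq by simp
    then have "k = k'"
      using rep[OF carr(5)] kw(1) kw'(1) rcos_self[OF carr(5) H] rcos_self[OF carr(6) H] by auto
    then have "s \<otimes> w = s' \<otimes> w'" using eq carr by simp
    then have "(s, w) = (s', w')"
      using dec[OF inH(1), of k] srs(1,2) kw(2) kw'(2) \<open>k = k'\<close>
      by (elim ex1E) (metis SigmaI fst_conv snd_conv)
    then show ?thesis using \<open>k = k'\<close> kw kw' by simp
  qed
  have "R \<subseteq> carrier G"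
  proof
    fix r assume "r \<in> R"
    then obtain k w where "k \<in> K1 \<union> K2" "w \<in> W k" "r = w \<otimes> k" using R_iff by blast
    then show "r \<in> carrier G" using WH HG KG by (metis m_closed subsetD)
  qed
  moreover have "R \<noteq> {}" using ex[OF one_closed] by auto
  moreover have "\<exists>!p. p \<in> S \<times> R \<and> g = fst p \<otimes> snd p" if "g \<in> carrier G" for g
  proof (rule ex_ex1I[OF ex[OF that]])
    fix p q assume "p \<in> S \<times> R \<and> g = fst p \<otimes> snd p" "q \<in> S \<times> R \<and> g = fst q \<otimes> snd q"
    then show "p = q" using uniq[of "fst p" "fst q" "snd p" "snd q"] by (auto simp: prod_eq_iff)
  qed
  ultimately show ?thesis
    using ne(1) SH HG unfolding direct_sum_decomp_def R_def by (intro conjI ballI) (assumption | blast)+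
qed

section \<open>A mixed radix system for the integers modulo a product of coprime numbers\<close>

text \<open>
  The digits can be recovered successively: \<open>j\<close> from the class modulo \<open>n1\<close>, then \<open>s\<close> from the
  class modulo \<open>n1 * p1\<close>, and last \<open>i\<close> and \<open>t\<close>, which are the remainder and the quotient
  of \<open>i + t * n2\<close> by \<open>n2\<close>. Hence the map is injective, and both sides have \<open>M\<close> elements.
\<close>

lemma mixed_radix_tiling:
  fixes n1 p1 n2 p2 \<beta> :: nat
  defines "M \<equiv> n1 * p1 * (n2 * p2)"
  defines "f \<equiv> \<lambda>((i, j), (t, s)).
    (i * (n1 * p1) + j * (n2 * p2) + t * (n1 * n2 * p1) + s * (\<beta> * n1)) mod M"
  assumes pos: "M > 0"
    and cop: "coprime (n1 * p1) (n2 * p2)" and \<beta>: "coprime \<beta> p1"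
  shows "bij_betw f (({..<n2} \<times> {..<n1}) \<times> ({..<p2} \<times> {..<p1})) {..<M}"
proof -
  let ?D = "({..<n2} \<times> {..<n1}) \<times> ({..<p2} \<times> {..<p1})"
  have pos': "n1 > 0" "p1 > 0" "n2 > 0" "p2 > 0" using pos by (auto simp: M_def)
  have inj: "inj_on f ?D"
  proof (rule inj_onI, clarsimp simp: f_def)
    fix i j t s i' j' t' s'
    assume b: "i < n2" "j < n1" "t < p2" "s < p1" "i' < n2" "j' < n1" "t' < p2" "s' < p1"
    assume "(i * (n1 * p1) + j * (n2 * p2) + t * (n1 * n2 * p1) + s * (\<beta> * n1)) mod M =
        (i' * (n1 * p1) + j' * (n2 * p2) + t' * (n1 * n2 * p1) + s' * (\<beta> * n1)) mod M"
    then have e: "[(n1 * p1) * (i + t * n2) + (j * (n2 * p2) + s * (\<beta> * n1)) =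
        (n1 * p1) * (i' + t' * n2) + (j' * (n2 * p2) + s' * (\<beta> * n1))] (mod M)"
      by (simp add: cong_def algebra_simps)
    have ea: "[j * (n2 * p2) + s * (\<beta> * n1) = j' * (n2 * p2) + s' * (\<beta> * n1)] (mod n1 * p1)"
      using cong_modulus_mult_nat[OF e[unfolded M_def]] by (simp add: cong_def)
    have "[j * (n2 * p2) = j' * (n2 * p2)] (mod n1)"
      using cong_modulus_mult_nat[OF ea] by (simp add: cong_def flip: mult.assoc)
    then have j: "j = j'"
      using b cop by (metis cong_mult_rcancel_nat cong_less_modulus_unique_nat
          coprime_mult_left_iff coprime_commute)
    have "[n1 * (s * \<beta>) = n1 * (s' * \<beta>)] (mod n1 * p1)"
      using ea unfolding j cong_add_lcancel_nat by (simp add: ac_simps)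
    then have "[s * \<beta> = s' * \<beta>] (mod p1)"
      using pos' by (simp add: cong_def mod_mult_mult1)
    then have s: "s = s'"
      using b \<beta> by (metis cong_mult_rcancel_nat cong_less_modulus_unique_nat)
    have "[(n1 * p1) * (i + t * n2) = (n1 * p1) * (i' + t' * n2)] (mod (n1 * p1) * (n2 * p2))"
      using e unfolding j s M_def by (simp add: cong_add_rcancel_nat)
    then have c: "[i + t * n2 = i' + t' * n2] (mod n2 * p2)"
      using pos' by (simp add: cong_def mod_mult_mult1)
    have bd: "x + y * n2 < n2 * p2" if "x < n2" "y < p2" for x y
    proof -
      have "x + y * n2 < Suc y * n2" using that by simp
      also have "\<dots> \<le> p2 * n2" using that by (intro mult_le_mono1) simp
      finally show ?thesis by (simp add: mult.commute)
    qed
    have q: "i + t * n2 = i' + t' * n2"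
      using cong_less_modulus_unique_nat[OF c] bd b by simp
    have "i = i'" using arg_cong[OF q, of "\<lambda>x. x mod n2"] b by simp
    then have "t = t'" using q pos' by simp
    then show "i = i' \<and> j = j' \<and> t = t' \<and> s = s'" using \<open>i = i'\<close> j s by simp
  qed
  have sub: "f ` ?D \<subseteq> {..<M}" using pos by (auto simp: f_def)
  have "card (f ` ?D) = card {..<M}"
    by (simp add: card_image[OF inj] card_cartesian_product M_def ac_simps)
  then have "f ` ?D = {..<M}" using sub card_subset_eq finite_lessThan by metis
  then show ?thesis using inj by (simp add: bij_betw_def)
qed

section \<open>Multiples of a divisor inside a cyclic group\<close>

text \<open>
  The isomorphism from \<open>\<int>\<^sub>M\<close> onto the multiples of \<open>d\<close> in \<open>\<int>\<^sub>N\<close>, where \<open>N = d * M\<close>,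
  composed with reduction modulo \<open>M\<close>. Taking all natural numbers as arguments keeps sums of
  progressions free of intermediate reductions.
\<close>

definition embed_residue :: "nat \<Rightarrow> nat \<Rightarrow> nat \<Rightarrow> int"
  where "embed_residue d M x = int (d * (x mod M))"

lemma multiples_mod_eq_image_embed_residue:
  "multiples_mod (d * M) (d * k) a = (\<lambda>i. embed_residue d M (i * k)) ` {..<a}"
proof -
  have "(i * (d * k)) mod (d * M) = d * ((i * k) mod M)" for i
    by (metis mult.left_commute mult_mod_right)
  then show ?thesis by (simp add: multiples_mod_def embed_residue_def)
qed

lemma embed_residue_add:
  "(embed_residue d M x + embed_residue d M y) mod int (d * M) = embed_residue d M (x + y)"
proof -
  have "(d * (x mod M) + d * (y mod M)) mod (d * M) = d * ((x + y) mod M)"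
    by (metis distrib_left mod_add_eq mult_mod_right)
  then show ?thesis unfolding embed_residue_def by (metis of_nat_add of_nat_mod)
qed

lemma embed_residue_eq_iff:
  assumes "d > 0"
  shows "embed_residue d M x = embed_residue d M y \<longleftrightarrow> [x = y] (mod M)"
  using assms by (simp add: embed_residue_def cong_def)

lemma set_mult_embed_residue:
  "((\<lambda>i. embed_residue d M (f i)) ` X) <#>\<^bsub>integer_mod_group (d * M)\<^esub>
     ((\<lambda>j. embed_residue d M (g j)) ` Y)
   = (\<lambda>(i, j). embed_residue d M (f i + g j)) ` (X \<times> Y)"
proof -
  have "X' <#>\<^bsub>integer_mod_group (d * M)\<^esub> Y' = (\<lambda>(x, y). (x + y) mod int (d * M)) ` (X' \<times> Y')"
    for X' Y'
    unfolding set_mult_def mult_integer_mod_group by (auto simp del: of_nat_mult)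
  then show ?thesis
    by (simp only: image_paired_Times[symmetric] image_image case_prod_unfold fst_conv snd_conv
        embed_residue_add)
qed

lemma multiples_mod_eq_dvd:
  assumes "d > 0" "M > 0"
  shows "multiples_mod (d * M) d M = {x \<in> carrier (integer_mod_group (d * M)). int d dvd x}"
proof -
  have "multiples_mod (d * M) d M = (\<lambda>i. int d * int i) ` {..<M}"
    using multiples_mod_eq_image_embed_residue[of d M 1 M] by (auto simp: embed_residue_def)
  also have "\<dots> = {x \<in> {0..<int (d * M)}. int d dvd x}"
  proof (intro equalityI subsetI)
    fix x assume "x \<in> {x \<in> {0..<int (d * M)}. int d dvd x}"
    then obtain q where q: "x = int d * q" "0 \<le> x" "x < int d * int M" by (auto elim: dvdE)
    then have "0 \<le> q" "q < int M" using assms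
      by (auto simp: zero_le_mult_iff mult_less_cancel_left)
    then show "x \<in> (\<lambda>i. int d * int i) ` {..<M}"
      using q by (intro image_eqI[of _ _ "nat q"]) auto
  qed (use assms in \<open>auto simp flip: of_nat_mult\<close>)
  finally show ?thesis using assms by (simp add: carrier_integer_mod_group)
qed

lemma subgroup_multiples_mod:
  assumes "d > 0" "M > 0"
  shows "subgroup (multiples_mod (d * M) d M) (integer_mod_group (d * M))"
proof -
  let ?G = "integer_mod_group (d * M)"
  interpret group ?G by simp
  have dvd: "int d dvd x mod int (d * M) \<longleftrightarrow> int d dvd x" for x
    by (simp add: dvd_mod_iff)
  show ?thesis
    unfolding multiples_mod_eq_dvd[OF assms]
  proof (rule subgroupI)
    show "{x \<in> carrier ?G. int d dvd x} \<noteq> {}"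
      using integer_mod_group_0 dvd_0_right by blast
  next
    fix x assume "x \<in> {x \<in> carrier ?G. int d dvd x}"
    then show "inv\<^bsub>?G\<^esub> x \<in> {x \<in> carrier ?G. int d dvd x}"
      using inv_closed[of x] dvd[of "- x"] by (simp del: of_nat_mult)
  next
    fix x y assume "x \<in> {x \<in> carrier ?G. int d dvd x}" "y \<in> {x \<in> carrier ?G. int d dvd x}"
    then show "x \<otimes>\<^bsub>?G\<^esub> y \<in> {x \<in> carrier ?G. int d dvd x}"
      using m_closed[of x y] dvd[of "x + y"] by (simp del: of_nat_mult)
  qed auto
qed

section \<open>Factorization of the subgroup\<close>

text \<open>
  This is the transport of the mixed radix system along the embedding: the digits \<open>i\<close>, \<open>j\<close> make
  up the first summand and the digits \<open>t\<close>, \<open>s\<close> the second. The hypotheses are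
  stated so that exchanging the indices 1 and 2 yields the other complement of the same set.
\<close>

lemma multiples_mod_direct_sum_decomp:
  fixes n1 p1 n2 p2 d \<beta> :: nat
  defines "N \<equiv> d * (n1 * p1 * (n2 * p2))"
  assumes pos: "N > 0"
    and cop: "coprime (n1 * p1) (n2 * p2)" and \<beta>: "coprime \<beta> p1"
  shows "direct_sum_decomp
    (integer_mod_group N\<lparr>carrier := multiples_mod N d (n1 * p1 * (n2 * p2))\<rparr>)
    (multiples_mod N (d * (n1 * p1)) n2 <#>\<^bsub>integer_mod_group N\<^esub>
       multiples_mod N (d * (n2 * p2)) n1)
    (multiples_mod N (d * (n1 * n2 * p1)) p2 <#>\<^bsub>integer_mod_group N\<^esub>
       multiples_mod N (d * (\<beta> * n1)) p1)"
  (is "direct_sum_decomp (?G\<lparr>carrier := ?H\<rparr>) ?S ?W")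
proof -
  define M where "M = n1 * p1 * (n2 * p2)"
  have N: "N = d * M" by (simp add: N_def M_def)
  have p: "d > 0" "M > 0" "n1 > 0" "p1 > 0" "n2 > 0" "p2 > 0"
    using pos by (auto simp: N_def M_def)
  define e where "e = embed_residue d M"
  define \<sigma> where "\<sigma> = (\<lambda>(i, j). i * (n1 * p1) + j * (n2 * p2))"
  define \<tau> where "\<tau> = (\<lambda>(t, s). t * (n1 * n2 * p1) + s * (\<beta> * n1))"
  let ?X = "{..<n2} \<times> {..<n1}" and ?Y = "{..<p2} \<times> {..<p1}"
  have bij: "bij_betw (\<lambda>(x, y). (\<sigma> x + \<tau> y) mod M) (?X \<times> ?Y) {..<M}"
    using mixed_radix_tiling[OF _ cop \<beta>] p(2)
    by (simp add: \<sigma>_def \<tau>_def M_def case_prod_unfold add.assoc)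
  have S: "?S = (\<lambda>x. e (\<sigma> x)) ` ?X"
    unfolding N multiples_mod_eq_image_embed_residue set_mult_embed_residue
    by (auto simp: e_def \<sigma>_def case_prod_unfold)
  have W: "?W = (\<lambda>y. e (\<tau> y)) ` ?Y"
    unfolding N multiples_mod_eq_image_embed_residue set_mult_embed_residue
    by (auto simp: e_def \<tau>_def case_prod_unfold)
  have H: "?H = e ` {..<M}"
    using multiples_mod_eq_image_embed_residue[of d M 1 M] by (simp add: N e_def M_def)
  have emod: "e x = e (x mod M)" for x by (simp add: e_def embed_residue_def)
  then have inH: "e x \<in> ?H" for x using H p(2) by (metis image_eqI lessThan_iff mod_less_divisor)
  have mult: "e x \<otimes>\<^bsub>?G\<^esub> e y = e (x + y)" for x y
    using embed_residue_add by (simp add: N e_def del: of_nat_mult)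
  have ex1: "\<exists>!p. p \<in> ?S \<times> ?W \<and> h = fst p \<otimes>\<^bsub>?G\<^esub> snd p" if "h \<in> ?H" for h
  proof -
    obtain m where m: "m < M" "h = e m" using \<open>h \<in> ?H\<close> unfolding H by blast
    have "m \<in> (\<lambda>(x, y). (\<sigma> x + \<tau> y) mod M) ` (?X \<times> ?Y)"
      unfolding bij_betw_imp_surj_on[OF bij] using m(1) by simp
    then obtain z where "z \<in> ?X \<times> ?Y" "m = (\<lambda>(x, y). (\<sigma> x + \<tau> y) mod M) z" by (rule imageE)
    then obtain x y where xy: "x \<in> ?X" "y \<in> ?Y" "m = (\<sigma> x + \<tau> y) mod M"
      by (metis case_prod_beta mem_Times_iff)
    have h: "h = e (\<sigma> x) \<otimes>\<^bsub>?G\<^esub> e (\<tau> y)" using m xy emod mult by metis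
    show ?thesis
    proof (rule ex1I[of _ "(e (\<sigma> x), e (\<tau> y))"])
      show "(e (\<sigma> x), e (\<tau> y)) \<in> ?S \<times> ?W \<and>
          h = fst (e (\<sigma> x), e (\<tau> y)) \<otimes>\<^bsub>?G\<^esub> snd (e (\<sigma> x), e (\<tau> y))"
        using h xy by (simp add: S W)
    next
      fix q assume q: "q \<in> ?S \<times> ?W \<and> h = fst q \<otimes>\<^bsub>?G\<^esub> snd q"
      then have "fst q \<in> ?S" "snd q \<in> ?W" by auto
      then obtain x' y' where "x' \<in> ?X" "y' \<in> ?Y" "fst q = e (\<sigma> x')" "snd q = e (\<tau> y')"
        unfolding S W by (elim imageE)
      then have q': "x' \<in> ?X" "y' \<in> ?Y" "q = (e (\<sigma> x'), e (\<tau> y'))"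
        by (simp_all add: prod_eq_iff)
      then have "e (\<sigma> x' + \<tau> y') = e (\<sigma> x + \<tau> y)" using q h mult by simp
      then have "(\<sigma> x' + \<tau> y') mod M = (\<sigma> x + \<tau> y) mod M"
        using embed_residue_eq_iff[OF p(1)] by (simp add: e_def cong_def)
      then have "(x', y') = (x, y)"
        using inj_onD[OF bij_betw_imp_inj_on[OF bij], of "(x', y')" "(x, y)"] q' xy by simp
      then show "q = (e (\<sigma> x), e (\<tau> y))" using q' by simp
    qed
  qed
  have "?S \<noteq> {}" "?W \<noteq> {}" using p by (auto simp: S W lessThan_empty_iff)
  moreover have "?S \<subseteq> ?H" "?W \<subseteq> ?H" using inH by (auto simp: S W)
  ultimately show ?thesis using ex1 by (simp add: direct_sum_decomp_def)
qed

section \<open>Non-periodicity\<close>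

text \<open>
  If \<open>j0\<close> were positive, adding the translation to the element with \<open>j = n1 - j0\<close> would
  produce the coordinate \<open>n1\<close> modulo \<open>n1 * p1\<close>, the first value past the end of the interval
  \<open>{..<n1}\<close>; as \<open>n1 < n1 * p1\<close>, it does not wrap around into the interval.
\<close>

lemma translation_stable_imp_zero_coordinate:
  fixes n1 p1 n2 p2 :: nat
  assumes cop: "coprime (n1 * p1) (n2 * p2)" and p1: "p1 > 1" and j0: "j0 < n1"
    and stable: "\<And>j. j < n1 \<Longrightarrow> \<exists>i'<n2. \<exists>j'<n1.
      [i0 * (n1 * p1) + (j0 + j) * (n2 * p2) = i' * (n1 * p1) + j' * (n2 * p2)] (mod n1 * p1 * (n2 * p2))"
  shows "j0 = 0"
proof (rule ccontr)
  assume "j0 \<noteq> 0"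
  then have "n1 - j0 < n1" "j0 + (n1 - j0) = n1" using j0 by auto
  then obtain i' j' where j': "j' < n1"
    and c: "[i0 * (n1 * p1) + n1 * (n2 * p2) = i' * (n1 * p1) + j' * (n2 * p2)] (mod n1 * p1 * (n2 * p2))"
    using stable[of "n1 - j0"] by auto
  have "[n1 * (n2 * p2) = j' * (n2 * p2)] (mod n1 * p1)"
    using cong_modulus_mult_nat[OF c] by (simp add: cong_def)
  then have "[n1 = j'] (mod n1 * p1)"
    using cop by (metis cong_mult_rcancel_nat coprime_commute)
  moreover have "n1 < n1 * p1" using p1 j0 by simp
  ultimately show False using cong_less_modulus_unique_nat j' by (metis less_irrefl less_trans)
qed

text \<open>
  Since the set contains 0, a period \<open>g\<close> is itself an element of the set and so has coordinates
  \<open>i0\<close> and \<open>j0\<close> in the two intervals. Translation by \<open>g\<close> adds them to the coordinates of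
  every element, which forces both to vanish.
\<close>

lemma sum_of_multiples_mod_not_periodic:
  fixes n1 p1 n2 p2 d :: nat
  defines "N \<equiv> d * (n1 * p1 * (n2 * p2))"
  assumes pos: "N > 0"
    and cop: "coprime (n1 * p1) (n2 * p2)" and p: "p1 > 1" "p2 > 1"
  shows "\<not> periodic_subset (integer_mod_group N)
    (multiples_mod N (d * (n1 * p1)) n2 <#>\<^bsub>integer_mod_group N\<^esub>
       multiples_mod N (d * (n2 * p2)) n1)"
  (is "\<not> periodic_subset ?G ?S")
proof
  define M where "M = n1 * p1 * (n2 * p2)"
  have N: "N = d * M" by (simp add: N_def M_def)
  have p': "d > 0" "n1 > 0" "n2 > 0" using pos by (auto simp: N_def)
  define e where "e = embed_residue d M"
  define \<sigma> where "\<sigma> i j = i * (n1 * p1) + j * (n2 * p2)" for i j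
  have S: "?S = (\<lambda>(i, j). e (\<sigma> i j)) ` ({..<n2} \<times> {..<n1})"
    unfolding N multiples_mod_eq_image_embed_residue set_mult_embed_residue
    by (auto simp: e_def \<sigma>_def case_prod_unfold)
  assume "periodic_subset ?G ?S"
  then obtain g where g: "g \<in> carrier ?G" "g \<noteq> 0" "?S #>\<^bsub>?G\<^esub> g = ?S"
    by (auto simp: periodic_subset_def)
  have step: "(x + g) mod int N \<in> ?S" if "x \<in> ?S" for x
    using that g(3) by (auto simp: r_coset_def)
  have "0 \<in> ?S" unfolding S using p'
    by (intro image_eqI[of _ _ "(0, 0)"]) (auto simp: e_def \<sigma>_def embed_residue_def)
  from step[OF this] have "g \<in> ?S"
    using g(1) pos by (simp add: carrier_integer_mod_group)
  then obtain i0 j0 where ij: "i0 < n2" "j0 < n1" "g = e (\<sigma> i0 j0)" unfolding S by auto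
  have stable: "\<exists>i'<n2. \<exists>j'<n1. [\<sigma> (i0 + i) (j0 + j) = \<sigma> i' j'] (mod M)"
    if "i < n2" "j < n1" for i j
  proof -
    have "e (\<sigma> i j) \<in> ?S" unfolding S using that by auto
    from step[OF this] have "e (\<sigma> i j + \<sigma> i0 j0) \<in> ?S"
      using embed_residue_add by (simp add: ij N e_def del: of_nat_mult)
    then obtain i' j' where "i' < n2" "j' < n1" "e (\<sigma> i j + \<sigma> i0 j0) = e (\<sigma> i' j')"
      unfolding S by auto
    moreover have "\<sigma> i j + \<sigma> i0 j0 = \<sigma> (i0 + i) (j0 + j)" by (simp add: \<sigma>_def algebra_simps)
    ultimately show ?thesis using embed_residue_eq_iff[OF p'(1)] by (metis e_def)
  qed
  have "j0 = 0"
  proof (rule translation_stable_imp_zero_coordinate[OF cop p(1) ij(2)])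
    show "\<exists>i'<n2. \<exists>j'<n1. [i0 * (n1 * p1) + (j0 + j) * (n2 * p2) =
        i' * (n1 * p1) + j' * (n2 * p2)] (mod n1 * p1 * (n2 * p2))" if "j < n1" for j
      using stable[OF p'(3) that] by (simp add: \<sigma>_def M_def)
  qed
  moreover have "i0 = 0"
  proof (rule translation_stable_imp_zero_coordinate[OF _ p(2) ij(1)])
    show "coprime (n2 * p2) (n1 * p1)" using cop by (simp add: coprime_commute)
    show "\<exists>j'<n1. \<exists>i'<n2. [j0 * (n2 * p2) + (i0 + i) * (n1 * p1) =
        j' * (n2 * p2) + i' * (n1 * p1)] (mod n2 * p2 * (n1 * p1))" if i: "i < n2" for i
    proof -
      obtain i' j' where "i' < n2" "j' < n1" "[\<sigma> (i0 + i) (j0 + 0) = \<sigma> i' j'] (mod M)"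
        using stable[OF i p'(2)] by blast
      moreover have "\<sigma> x y = y * (n2 * p2) + x * (n1 * p1)" for x y
        by (simp add: \<sigma>_def)
      moreover have "M = n2 * p2 * (n1 * p1)" by (simp add: M_def)
      ultimately show ?thesis by (metis add_0_right)
    qed
  qed
  ultimately show False using g(2) ij(3) by (simp add: e_def \<sigma>_def embed_residue_def)
qed

section \<open>The Vuza canon\<close>

lemma (in comm_group) set_mult_commute:
  assumes "X \<subseteq> carrier G" "Y \<subseteq> carrier G"
  shows "X <#> Y = Y <#> X"
  using assms m_comm unfolding set_mult_def by blast

lemma multiples_mod_closed:
  "N > 0 \<Longrightarrow> multiples_mod N k a \<subseteq> carrier (integer_mod_group N)"
  by (auto simp: multiples_mod_def carrier_integer_mod_group)

theorem theorem14:
  fixes p\<^sub>1 p\<^sub>2 n\<^sub>1 n\<^sub>2 n\<^sub>3 N \<alpha> \<beta> :: nat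
    and G :: "int monoid"
    and H K K\<^sub>1 K\<^sub>2 A B U V U' V' S R :: "int set"
  assumes "prime p\<^sub>1" and "prime p\<^sub>2" and "p\<^sub>1 \<noteq> p\<^sub>2"
    and "n\<^sub>1 > 0" and "n\<^sub>2 > 0" and "n\<^sub>3 > 0"
    and "coprime (n\<^sub>1 * p\<^sub>1) (n\<^sub>2 * p\<^sub>2)"
    and "N = n\<^sub>1 * n\<^sub>2 * n\<^sub>3 * p\<^sub>1 * p\<^sub>2"
    and "G = integer_mod_group N"
    and "H = multiples_mod N n\<^sub>3 (n\<^sub>1 * p\<^sub>1 * n\<^sub>2 * p\<^sub>2)"
    and "complete_coset_reps G H K"
    and "K = K\<^sub>1 \<union> K\<^sub>2" and "K\<^sub>1 \<inter> K\<^sub>2 = {}"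
    and "\<alpha> \<in> {1, n\<^sub>1, p\<^sub>1}" and "\<beta> \<in> {1, n\<^sub>2, p\<^sub>2}"
    and "A = multiples_mod N (n\<^sub>1 * p\<^sub>1 * n\<^sub>3) n\<^sub>2"
    and "B = multiples_mod N (n\<^sub>2 * p\<^sub>2 * n\<^sub>3) n\<^sub>1"
    and "U = multiples_mod N (n\<^sub>1 * n\<^sub>2 * n\<^sub>3 * p\<^sub>1) p\<^sub>2"
    and "V = multiples_mod N (n\<^sub>1 * n\<^sub>2 * n\<^sub>3 * p\<^sub>2) p\<^sub>1"
    and "U' = multiples_mod N (\<alpha> * n\<^sub>2 * n\<^sub>3) p\<^sub>2"
    and "V' = multiples_mod N (\<beta> * n\<^sub>1 * n\<^sub>3) p\<^sub>1"
    and "S = A <#>\<^bsub>G\<^esub> B"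
    and "R = (U <#>\<^bsub>G\<^esub> V' <#>\<^bsub>G\<^esub> K\<^sub>1) \<union> (U' <#>\<^bsub>G\<^esub> V <#>\<^bsub>G\<^esub> K\<^sub>2)"
    and "non_periodic_subset G R"
  shows "vuza_canon G S R"
proof -
  have pgt: "p\<^sub>1 > 1" "p\<^sub>2 > 1" using assms(1,2) prime_gt_1_nat by auto
  have N: "N = n\<^sub>3 * (n\<^sub>1 * p\<^sub>1 * (n\<^sub>2 * p\<^sub>2))" "N = n\<^sub>3 * (n\<^sub>2 * p\<^sub>2 * (n\<^sub>1 * p\<^sub>1))"
    by (simp_all add: assms(8) ac_simps)
  have Npos: "N > 0" using assms(4-6) pgt by (simp add: N)
  have \<beta>: "coprime \<beta> p\<^sub>1" and \<alpha>: "coprime \<alpha> p\<^sub>2"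
    using assms(7,14,15) by (auto simp: coprime_commute)
  interpret comm_group G using assms(9) by simp
  have closed: "multiples_mod N k a \<subseteq> carrier G" for k a
    using multiples_mod_closed[OF Npos] assms(9) by simp
  have Hsub: "subgroup H G"
    using subgroup_multiples_mod[of n\<^sub>3 "n\<^sub>1 * p\<^sub>1 * (n\<^sub>2 * p\<^sub>2)"] Npos assms(9,10)
    by (simp add: N(1) mult.assoc)
  have W1: "direct_sum_decomp (G\<lparr>carrier := H\<rparr>) S (U <#>\<^bsub>G\<^esub> V')"
    using multiples_mod_direct_sum_decomp[of n\<^sub>3 n\<^sub>1 p\<^sub>1 n\<^sub>2 p\<^sub>2 \<beta>, folded N(1), OF Npos assms(7) \<beta>]
    by (simp add: assms(9,10,16,17,18,21,22) ac_simps)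
  \<comment> \<open>The same factorization with the indices exchanged, so that \<open>\<alpha>\<close> takes the role of \<open>\<beta>\<close>.\<close>
  have "direct_sum_decomp (G\<lparr>carrier := H\<rparr>) (B <#>\<^bsub>G\<^esub> A) (V <#>\<^bsub>G\<^esub> U')"
    using multiples_mod_direct_sum_decomp[of n\<^sub>3 n\<^sub>2 p\<^sub>2 n\<^sub>1 p\<^sub>1 \<alpha>, folded N(2), OF Npos _ \<alpha>] assms(7)
    by (simp add: assms(9,10,16,17,19,20) ac_simps coprime_commute)
  then have W2: "direct_sum_decomp (G\<lparr>carrier := H\<rparr>) S (U' <#>\<^bsub>G\<^esub> V)"
    using set_mult_commute closed by (simp add: assms(16,17,19,20,22))
  have D: "direct_sum_decomp G S R"
    unfolding assms(23)
    using direct_sum_decomp_split_transversal[OF Hsub _ assms(13) W1 W2] assms(11,12) by simp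
  have "\<not> periodic_subset G S"
    using sum_of_multiples_mod_not_periodic[of n\<^sub>3 n\<^sub>1 p\<^sub>1 n\<^sub>2 p\<^sub>2, folded N(1), OF Npos assms(7) pgt]
    by (simp add: assms(9,16,17,22) ac_simps)
  then show ?thesis
    using D assms(24) by (simp add: vuza_canon_def non_periodic_subset_def direct_sum_decomp_def)
qed

end
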